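(* For every integer $n \geq 3$, the prism $C_n \,\square\, K_2$ is $(31,4)$-total-threshold-colorable.
   Context: All graphs are finite, simple and undirected. A near-far-labeling of a graph $G$ is a pair $(N,F)$ with $N \subseteq E(G)$ and $F = E(G)\setminus N$ (edges in $N$ are "near", edges in $F$ are "far"). For integers $r \geq t$, an $(r,t)$-threshold-coloring of $G$ with respect to $(N,F)$ is a map $c: V(G) \to \{0,\ldots,r-1\}$ such that $|c(u)-c(v)| \leq t$ for every $uv \in N$ and $|c(u)-c(v)| > t$ for every $uv \in F$. A graph is $(r,t)$-total-threshold-colorable if it admits an $(r,t)$-threshold-coloring with respect to every near-far-labeling. $G \,\square\, H$ denotes the Cartesian product: vertex set $V(G)\times V(H)$, with $(v,w),(x,y)$ adjacent iff either $v=x$ and $wy \in E(H)$, or $w=y$ and $vx \in E(G)$. $C_n$ is the cycle of length $n$ and $K_2$ the complete graph on two vertices. *)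

theory Defs
  imports Main
begin

record 'a ugraph =
  verts :: "'a set"
  edges :: "'a set set"

definition simple_graph :: "'a ugraph \<Rightarrow> bool" where
  "simple_graph G \<longleftrightarrow>
     finite (verts G) \<and> (\<forall>e\<in>edges G. e \<subseteq> verts G \<and> card e = 2)"

definition near_far_labeling :: "'a ugraph \<Rightarrow> 'a set set \<Rightarrow> 'a set set \<Rightarrow> bool" where
  "near_far_labeling G N F \<longleftrightarrow> N \<subseteq> edges G \<and> F = edges G - N"

text \<open>Colors are integers, so that the difference of two colors is not truncated. The convention
  \<open>r \<ge> t\<close> on the parameters is left to the user of the definition. Values of \<open>c\<close> outside the
  vertex set are irrelevant.\<close>

definition threshold_coloring ::
  "int \<Rightarrow> int \<Rightarrow> 'a ugraph \<Rightarrow> 'a set set \<Rightarrow> 'a set set \<Rightarrow> ('a \<Rightarrow> int) \<Rightarrow> bool" where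
  "threshold_coloring r t G N F c \<longleftrightarrow>
     (\<forall>v\<in>verts G. c v \<in> {0..r - 1}) \<and>
     (\<forall>u v. {u, v} \<in> N \<longrightarrow> \<bar>c u - c v\<bar> \<le> t) \<and>
     (\<forall>u v. {u, v} \<in> F \<longrightarrow> \<bar>c u - c v\<bar> > t)"

definition total_threshold_colorable :: "int \<Rightarrow> int \<Rightarrow> 'a ugraph \<Rightarrow> bool" where
  "total_threshold_colorable r t G \<longleftrightarrow>
     (\<forall>N F. near_far_labeling G N F \<longrightarrow> (\<exists>c. threshold_coloring r t G N F c))"

definition cartesian_product :: "'a ugraph \<Rightarrow> 'b ugraph \<Rightarrow> ('a \<times> 'b) ugraph"
    (infixl "\<box>" 70) where
  "G \<box> H =
     \<lparr>verts = verts G \<times> verts H,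
      edges = {{(v, w), (x, y)} | v w x y.
                 (v, w) \<in> verts G \<times> verts H \<and> (x, y) \<in> verts G \<times> verts H \<and>
                 (v = x \<and> {w, y} \<in> edges H \<or> w = y \<and> {v, x} \<in> edges G)}\<rparr>"

text \<open>This is the cycle of length \<open>n\<close> only for \<open>n \<ge> 3\<close>; for smaller \<open>n\<close> the formula degenerates
  (it yields a loop for \<open>n = 1\<close> and a single edge for \<open>n = 2\<close>).\<close>

definition cycle_graph :: "nat \<Rightarrow> nat ugraph" where
  "cycle_graph n = \<lparr>verts = {..<n}, edges = {{i, (i + 1) mod n} | i. i < n}\<rparr>"

definition complete_graph :: "nat \<Rightarrow> nat ugraph" where
  "complete_graph n = \<lparr>verts = {..<n}, edges = {{i, j} | i j. i < n \<and> j < n \<and> i \<noteq> j}\<rparr>"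

lemma simple_graph_cycle_graph:
  assumes "n \<ge> 3"
  shows "simple_graph (cycle_graph n)"
proof -
  have "(i + 1) mod n < n \<and> i \<noteq> (i + 1) mod n" if "i < n" for i
    using assms that by (cases "i + 1 = n") auto
  then show ?thesis
    by (auto simp: simple_graph_def cycle_graph_def card_2_iff)
qed

lemma simple_graph_complete_graph: "simple_graph (complete_graph n)"
  by (auto simp: simple_graph_def complete_graph_def)

lemma simple_graph_cartesian_product:
  assumes "simple_graph G" and "simple_graph H"
  shows "simple_graph (G \<box> H)"
proof -
  have "w \<noteq> y" if "{w, y} \<in> edges H" for w y
    using assms(2) that by (force simp: simple_graph_def)
  moreover have "v \<noteq> x" if "{v, x} \<in> edges G" for v x
    using assms(1) that by (force simp: simple_graph_def)
  ultimately show ?thesis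
    using assms by (auto simp: simple_graph_def cartesian_product_def card_insert_if)
qed

end

theory Submission
  imports Defs
begin

text \<open>Read the prism as a cyclic word: the letter of position \<open>i\<close> records which of the two rail edges
  from position \<open>i\<close> to position \<open>i + 1\<close>, and whether the rung at position \<open>i + 1\<close>, are near. A
  coloring is a closed walk through pairs of colors that spells this word.

  If some rung is near, start there with the colors \<open>(14, 16)\<close>. Every letter leads from each set
  of a finite family of sets of color pairs onto some set of the next family, the third family
  is mapped to itself, and in it every set that contains a near pair contains \<open>(14, 16)\<close>. Hence every
  word of length at least three that ends in a near rung can be closed up. If all rungs are far,
  the rails are colored independently, with colors \<open>0..10\<close> and \<open>20..30\<close>; the same argument works on
  a single rail.\<close>

subsection \<open>Walks that spell a word\<close>

definition walk :: "('l \<Rightarrow> 's \<Rightarrow> 's \<Rightarrow> bool) \<Rightarrow> (nat \<Rightarrow> 'l) \<Rightarrow> nat \<Rightarrow> (nat \<Rightarrow> 's) \<Rightarrow> bool" where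
  "walk R w n c \<longleftrightarrow> (\<forall>i<n. R (w i) (c i) (c (Suc i)))"

text \<open>\<open>Y\<close> may be any subset of the image of \<open>X\<close> under the letter
  \<open>l\<close>. Asking only for predecessors, not for full images, is what allows small
  families.\<close>

definition covers :: "('l \<Rightarrow> 's \<Rightarrow> 's \<Rightarrow> bool) \<Rightarrow> 's set set \<Rightarrow> 's set set \<Rightarrow> bool" where
  "covers R \<A> \<B> \<longleftrightarrow> (\<forall>X\<in>\<A>. \<forall>l. \<exists>Y\<in>\<B>. \<forall>y\<in>Y. \<exists>x\<in>X. R l x y)"

lemma walk_snoc:
  assumes "walk R w n c" and "R (w n) (c n) y"
  shows "\<exists>d. walk R w (Suc n) d \<and> d 0 = c 0 \<and> d (Suc n) = y"
  using assms by (intro exI[of _ "c(Suc n := y)"]) (auto simp: walk_def less_Suc_eq)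

lemma covers_walk_Suc:
  assumes "covers R \<A> \<B>"
    and "\<exists>X\<in>\<A>. \<forall>x\<in>X. \<exists>c. walk R w n c \<and> c 0 = x\<^sub>0 \<and> c n = x"
  shows "\<exists>Y\<in>\<B>. \<forall>y\<in>Y. \<exists>c. walk R w (Suc n) c \<and> c 0 = x\<^sub>0 \<and> c (Suc n) = y"
proof -
  from assms(2) obtain X
    where X: "X \<in> \<A>" "\<forall>x\<in>X. \<exists>c. walk R w n c \<and> c 0 = x\<^sub>0 \<and> c n = x"
    by (rule bexE)
  with assms(1) have "\<exists>Y\<in>\<B>. \<forall>y\<in>Y. \<exists>x\<in>X. R (w n) x y"
    unfolding covers_def by simp
  then obtain Y where Y: "Y \<in> \<B>" "\<forall>y\<in>Y. \<exists>x\<in>X. R (w n) x y"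
    by (rule bexE)
  show ?thesis
  proof (intro bexI ballI)
    show "Y \<in> \<B>"
      by (rule Y(1))
    fix y
    assume "y \<in> Y"
    then obtain x where "x \<in> X" and step: "R (w n) x y"
      using Y(2) by blast
    then obtain c where c: "walk R w n c" "c 0 = x\<^sub>0" "c n = x"
      using X(2) by blast
    then show "\<exists>c. walk R w (Suc n) c \<and> c 0 = x\<^sub>0 \<and> c (Suc n) = y"
      using walk_snoc[of R w n c y] step by simp
  qed
qed

text \<open>Three letters lead from the single state into \<open>\<C>\<close>, which then reproduces
  itself; this is where length at least three enters.\<close>

lemma covers_walk:
  assumes "covers R {{x\<^sub>0}} \<A>" "covers R \<A> \<B>" "covers R \<B> \<C>" "covers R \<C> \<C>" and "n \<ge> 3"
  shows "\<exists>Y\<in>\<C>. \<forall>y\<in>Y. \<exists>c. walk R w n c \<and> c 0 = x\<^sub>0 \<and> c n = y"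
  using \<open>n \<ge> 3\<close>
proof (induction n rule: dec_induct)
  case base
  have "\<exists>X\<in>{{x\<^sub>0}}. \<forall>x\<in>X. \<exists>c. walk R w 0 c \<and> c 0 = x\<^sub>0 \<and> c 0 = x"
    by (auto simp: walk_def)
  from covers_walk_Suc[OF assms(3) covers_walk_Suc[OF assms(2) covers_walk_Suc[OF assms(1) this]]]
  show ?case
    by (simp add: numeral_3_eq_3)
next
  case (step n)
  show ?case
    by (rule covers_walk_Suc[OF assms(4) step.IH])
qed

text \<open>Functions on the positions of the cycle are represented as periodic sequences, so that
  \<open>Suc i\<close> needs no special case at the wrap-around.\<close>

definition periodic :: "nat \<Rightarrow> (nat \<Rightarrow> 'a) \<Rightarrow> bool" where
  "periodic n f \<longleftrightarrow> (\<forall>i. f (i + n) = f i)"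

lemma periodic_mod:
  assumes "periodic n f"
  shows "f (i mod n) = f i"
proof -
  have "f (j + k * n) = f j" for j k
  proof (induction k)
    case (Suc k)
    have "f (j + Suc k * n) = f ((j + k * n) + n)"
      by (simp add: algebra_simps)
    then show ?case
      using Suc assms by (simp only: periodic_def)
  qed simp
  from this[of "i mod n" "i div n"] show ?thesis
    by simp
qed

lemma periodic_extension:
  assumes "walk R w n c" and "c n = c 0" and "periodic n w" and "n > 0"
  shows "\<exists>d. periodic n d \<and> (\<forall>i. R (w i) (d i) (d (Suc i)))"
proof (intro exI conjI allI)
  let ?d = "\<lambda>i. c (i mod n)"
  show "periodic n ?d"
    by (simp add: periodic_def)
  fix i
  have "i mod n < n"
    using \<open>n > 0\<close> by simp
  then have "R (w (i mod n)) (c (i mod n)) (c (Suc (i mod n)))"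
    using assms(1) by (simp add: walk_def)
  \<comment> \<open>At the wrap-around \<open>Suc (i mod n)\<close> is \<open>n\<close>, and
    closedness replaces \<open>c n\<close> by \<open>c 0\<close>.\<close>
  moreover have "c (Suc (i mod n)) = c (Suc i mod n)"
    using assms(2) by (simp add: mod_Suc)
  ultimately show "R (w i) (?d i) (?d (Suc i))"
    using periodic_mod[OF assms(3)] by simp
qed

lemma periodic_unshift:
  assumes "periodic n d" and "\<forall>i. R (w (i + m)) (d i) (d (Suc i))" and "periodic n w" and "m \<le> n"
  shows "\<exists>c. periodic n c \<and> (\<forall>i. R (w i) (c i) (c (Suc i)))"
proof (intro exI conjI allI)
  \<comment> \<open>Shifting back by \<open>m\<close> is shifting forward by \<open>n - m\<close>,
    which avoids negative indices; the two shifts add up to the period.\<close>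
  let ?c = "\<lambda>i. d (i + (n - m))"
  have "i + n + (n - m) = i + (n - m) + n" for i
    by simp
  then show "periodic n ?c"
    using assms(1) by (simp only: periodic_def) simp
  fix i
  have "R (w (i + (n - m) + m)) (?c i) (?c (Suc i))"
    using assms(2) by (metis add_Suc)
  moreover have "w (i + (n - m) + m) = w i"
    using assms(3,4) by (simp add: periodic_def)
  ultimately show "R (w i) (?c i) (?c (Suc i))"
    by simp
qed

subsection \<open>Colorings of a single rail\<close>

definition near :: "int \<Rightarrow> int \<Rightarrow> bool" where
  "near a b \<longleftrightarrow> \<bar>a - b\<bar> \<le> 4"

text \<open>Only the target color is bounded: on a closed walk every state is the target of some
  step.\<close>

definition rail_step :: "bool \<Rightarrow> int \<Rightarrow> int \<Rightarrow> bool" where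
  "rail_step p a b \<longleftrightarrow> b \<in> {0..10} \<and> near a b = p"

lemma rail_coloring:
  assumes "n \<ge> 3" and "periodic n p"
  shows "\<exists>c. periodic n c \<and> (\<forall>i. c i \<in> {0..10} \<and> near (c i) (c (Suc i)) = p i)"
proof -
  \<comment> \<open>From the middle color 5, near steps reach 1 and 9, far steps 0 and 10. In the
    last family a near step can stay put and a far step can move by 5. Its only set contains the
    start 5, so the walk can be closed.\<close>
  have "covers rail_step {{5}} {{0, 10}, {1, 9}}"
    and "covers rail_step {{0, 10}, {1, 9}} {{0, 1, 9, 10}}"
    and "covers rail_step {{0, 1, 9, 10}} {{0, 5, 10}}"
    and "covers rail_step {{0, 5, 10}} {{0, 5, 10}}"
    by (simp_all add: covers_def rail_step_def near_def all_bool_eq)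
  from covers_walk[OF this \<open>n \<ge> 3\<close>, of p]
  obtain c where "walk rail_step p n c" "c n = c 0"
    by auto
  then obtain d where d: "periodic n d" "\<forall>i. rail_step (p i) (d i) (d (Suc i))"
    using periodic_extension assms by (metis less_le_trans zero_less_numeral)
  have "d i \<in> {0..10}" for i
  proof -
    have "d (Suc (i + n - 1)) = d i"
      using d(1) \<open>n \<ge> 3\<close> by (simp add: periodic_def)
    then show ?thesis
      using d(2) unfolding rail_step_def by metis
  qed
  then show ?thesis
    using d unfolding rail_step_def by blast
qed

subsection \<open>Colorings of the prism\<close>

text \<open>The rung is tested at the target only; the rung at the source is tested by the
  cyclically preceding letter.\<close>

fun prism_step :: "bool \<times> bool \<times> bool \<Rightarrow> int \<times> int \<Rightarrow> int \<times> int \<Rightarrow> bool" where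
  "prism_step (p, q, s) (a, b) (a', b') \<longleftrightarrow>
     a' \<in> {0..30} \<and> b' \<in> {0..30} \<and> near a a' = p \<and> near b b' = q \<and> near a' b' = s"

text \<open>The three families were found by computer: the full sets of states reachable from \<open>(14, 16)\<close>
  were thinned out greedily for as long as the covering conditions survived.\<close>

definition family1 :: "(int \<times> int) set set" where
  "family1 = {
   {(10, 12), (14, 17), (15, 12), (17, 20), (18, 14)},
   {(10, 15), (10, 20), (15, 20), (17, 12), (18, 12), (18, 13)},
   {(10, 6), (10, 7), (11, 9), (15, 11), (17, 21), (18, 21), (18, 22)},
   {(5, 12), (7, 19), (9, 14), (9, 18), (19, 13), (22, 16), (24, 12), (27, 20)},
   {(10, 4), (10, 22), (11, 25), (16, 8), (16, 21), (17, 4), (17, 22), (18, 11)},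
   {(8, 12), (9, 12), (9, 13), (19, 15), (19, 16), (20, 19), (22, 20), (23, 19), (24, 20)},
   {(3, 10), (6, 27), (8, 3), (9, 21), (19, 10), (22, 8), (22, 29), (26, 21), (30, 22)},
   {(1, 5), (3, 3), (6, 9), (8, 4), (9, 7), (9, 10), (19, 22), (23, 24), (24, 21), (25, 29), (27, 23)}}"

definition family2 :: "(int \<times> int) set set" where
  "family2 = {
   {(8, 11), (10, 14), (13, 9), (18, 22), (19, 23), (21, 17)},
   {(7, 13), (8, 3), (16, 24), (18, 12), (20, 25), (22, 17)},
   {(4, 12), (7, 14), (12, 7), (15, 20), (20, 27), (23, 17)},
   {(7, 13), (10, 16), (13, 8), (16, 21), (19, 24), (20, 15)},
   {(6, 7), (8, 4), (12, 12), (16, 14), (17, 21), (20, 24), (21, 19)},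
   {(3, 6), (5, 2), (10, 7), (13, 17), (15, 11), (23, 19), (24, 24), (28, 26)},
   {(2, 8), (5, 12), (9, 15), (10, 20), (12, 22), (16, 9), (24, 13), (25, 20)},
   {(8, 29), (9, 20), (10, 5), (13, 18), (16, 11), (20, 26), (21, 5), (21, 14)},
   {(5, 4), (5, 7), (10, 7), (13, 17), (15, 11), (17, 21), (19, 20), (27, 24), (27, 29)},
   {(7, 8), (10, 11), (11, 15), (13, 12), (16, 16), (21, 19), (23, 21), (27, 23), (28, 24)}}"

definition family3 :: "(int \<times> int) set set" where
  "family3 = {
   {(9, 14), (10, 5), (15, 20), (16, 11), (21, 27), (23, 18)},
   {(7, 9), (10, 14), (14, 10), (14, 16), (16, 20), (20, 16), (23, 24)},
   {(3, 8), (9, 14), (12, 19), (17, 10), (19, 12), (25, 20), (28, 23)}}"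

text \<open>Distinct letters have disjoint images from a single state, so \<open>family1\<close>
  holds exactly one set for each of the eight letters.\<close>

lemma covers_start_family1: "covers prism_step {{(14, 16)}} family1"
  by code_simp

lemma covers_family1_family2: "covers prism_step family1 family2"
  by code_simp

lemma covers_family2_family3: "covers prism_step family2 family3"
  by code_simp

lemma covers_family3_family3: "covers prism_step family3 family3"
  by code_simp

text \<open>This suffices for closing up: every state of the final set ends a walk that spells the
  word, so if the last rung is near, no state of that set is far and the one supplied here is
  \<open>(14, 16)\<close>.\<close>

lemma family3_near: "\<forall>X\<in>family3. \<exists>(a, b)\<in>X. (a, b) = (14, 16) \<or> \<not> near a b"
  by code_simp

lemma prism_word_near:
  assumes "n \<ge> 3" and "w (n - 1) = (p, q, True)"
  shows "\<exists>c. walk prism_step w n c \<and> c n = c 0"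
proof -
  obtain Y where Y: "Y \<in> family3"
    "\<forall>y\<in>Y. \<exists>c. walk prism_step w n c \<and> c 0 = (14, 16) \<and> c n = y"
    using covers_walk[OF covers_start_family1 covers_family1_family2 covers_family2_family3
        covers_family3_family3 \<open>n \<ge> 3\<close>] by blast
  then obtain a b where "(a, b) \<in> Y" and ab: "(a, b) = (14, 16) \<or> \<not> near a b"
    using family3_near by blast
  then obtain c where c: "walk prism_step w n c" "c 0 = (14, 16)" "c n = (a, b)"
    using Y(2) by blast
  have "prism_step (p, q, True) (c (n - 1)) (a, b)"
    using c(1,3) assms unfolding walk_def
    by (metis Suc_diff_1 diff_less less_le_trans zero_less_numeral zero_less_one)
  then have "near a b"
    by (cases "c (n - 1)") simp
  then show ?thesis
    using c ab by metis
qed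

lemma prism_labels:
  assumes "n \<ge> 3" and "periodic n p" and "periodic n q" and "periodic n s"
  shows "\<exists>a b. periodic n a \<and> periodic n b \<and>
    (\<forall>i. a i \<in> {0..30} \<and> b i \<in> {0..30} \<and> near (a i) (a (Suc i)) = p i \<and>
      near (b i) (b (Suc i)) = q i \<and> near (a i) (b i) = s i)"
proof (cases "\<exists>i. s i")
  case False
  obtain a where a: "periodic n a" "\<forall>i. a i \<in> {0..10} \<and> near (a i) (a (Suc i)) = p i"
    using rail_coloring assms by blast
  obtain b where b: "periodic n b" "\<forall>i. b i \<in> {0..10} \<and> near (b i) (b (Suc i)) = q i"
    using rail_coloring assms by blast
  \<comment> \<open>Colors from \<open>0..10\<close> and \<open>20..30\<close> differ by at least
    10, so every rung is far; the shift keeps differences along the rail.\<close>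
  have shift: "periodic n (\<lambda>i. b i + 20)"
    using b(1) by (simp add: periodic_def)
  have "a i \<in> {0..30} \<and> b i + 20 \<in> {0..30} \<and> near (a i) (a (Suc i)) = p i \<and>
      near (b i + 20) (b (Suc i) + 20) = q i \<and> near (a i) (b i + 20) = s i" for i
  proof -
    have "a i \<in> {0..10}" "b i \<in> {0..10}"
      using a(2) b(2) by auto
    then have "\<not> near (a i) (b i + 20)"
      by (simp add: near_def)
    moreover have "near (b i + 20) (b (Suc i) + 20) = near (b i) (b (Suc i))"
      by (simp add: near_def)
    moreover have "a i \<in> {0..30}" "b i + 20 \<in> {0..30}"
      using \<open>a i \<in> {0..10}\<close> \<open>b i \<in> {0..10}\<close> by auto
    ultimately show ?thesis
      using a(2) b(2) False by blast
  qed
  then have labels: "\<forall>i. a i \<in> {0..30} \<and> b i + 20 \<in> {0..30} \<and> near (a i) (a (Suc i)) = p i \<and>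
      near (b i + 20) (b (Suc i) + 20) = q i \<and> near (a i) (b i + 20) = s i"
    by blast
  show ?thesis
    by (rule exI[of _ a], rule exI[of _ "\<lambda>i. b i + 20"], intro conjI a(1) shift labels)
next
  case True
  define w where "w i = (p i, q i, s (Suc i))" for i
  obtain i where "s i"
    using True by blast
  define m where "m = i mod n"
  have "m \<le> n" "s m"
    using \<open>s i\<close> \<open>n \<ge> 3\<close> periodic_mod[OF \<open>periodic n s\<close>] by (auto simp: m_def less_imp_le)
  have w: "periodic n w"
    using assms by (simp add: periodic_def w_def flip: add_Suc)
  have wm: "periodic n (\<lambda>i. w (i + m))"
  proof -
    have "i + n + m = i + m + n" for i
      by simp
    then show ?thesis
      using w by (simp only: periodic_def) simp
  qed
  \<comment> \<open>After rotation by \<open>m\<close> the last letter carries the rung at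
    \<open>m + n\<close>, which by periodicity is the near rung at \<open>m\<close>.\<close>
  have "Suc (n - 1 + m) = m + n"
    using \<open>n \<ge> 3\<close> by simp
  then have "w (n - 1 + m) = (p (n - 1 + m), q (n - 1 + m), True)"
    using \<open>s m\<close> \<open>periodic n s\<close> by (simp only: w_def periodic_def)
  from prism_word_near[OF \<open>n \<ge> 3\<close>, of "\<lambda>i. w (i + m)", OF this]
  obtain c where c: "walk prism_step (\<lambda>i. w (i + m)) n c" "c n = c 0"
    by blast
  have "n > 0"
    using \<open>n \<ge> 3\<close> by simp
  obtain d where "periodic n d" "\<forall>i. prism_step (w (i + m)) (d i) (d (Suc i))"
    using periodic_extension[OF c wm \<open>n > 0\<close>] by blast
  then obtain e where e: "periodic n e" "\<forall>i. prism_step (w i) (e i) (e (Suc i))"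
    using periodic_unshift w \<open>m \<le> n\<close> by metis
  have step: "fst (e (Suc i)) \<in> {0..30} \<and> snd (e (Suc i)) \<in> {0..30} \<and>
      near (fst (e i)) (fst (e (Suc i))) = p i \<and> near (snd (e i)) (snd (e (Suc i))) = q i \<and>
      near (fst (e (Suc i))) (snd (e (Suc i))) = s (Suc i)" for i
    using e(2)[rule_format, of i] by (cases "e i"; cases "e (Suc i)") (simp add: w_def)
  \<comment> \<open>The range and rung facts in \<open>step\<close> concern successor positions;
    \<open>i + n\<close> is one even for \<open>i = 0\<close>, and carries the same colors as
    \<open>i\<close>.\<close>
  have "fst (e i) \<in> {0..30} \<and> snd (e i) \<in> {0..30} \<and> near (fst (e i)) (snd (e i)) = s i" for i
  proof -
    have "Suc (i + n - 1) = i + n"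
      using \<open>n > 0\<close> by simp
    then show ?thesis
      using step[of "i + n - 1"] e(1) \<open>periodic n s\<close> by (simp add: periodic_def)
  qed
  then have labels: "\<forall>i. fst (e i) \<in> {0..30} \<and> snd (e i) \<in> {0..30} \<and>
      near (fst (e i)) (fst (e (Suc i))) = p i \<and> near (snd (e i)) (snd (e (Suc i))) = q i \<and>
      near (fst (e i)) (snd (e i)) = s i"
    using step by blast
  have periodic: "periodic n (\<lambda>i. fst (e i))" "periodic n (\<lambda>i. snd (e i))"
    using e(1) by (simp_all add: periodic_def)
  show ?thesis
    by (rule exI[of _ "\<lambda>i. fst (e i)"], rule exI[of _ "\<lambda>i. snd (e i)"], intro conjI periodic labels)
qed

text \<open>Brings unordered edges into the indexed form of \<open>prism_labels\<close>: rails point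
  to the next position modulo \<open>n\<close>, rungs from 0 to 1.\<close>

lemma prism_edge_cases:
  assumes "e \<in> edges (cycle_graph n \<box> complete_graph 2)"
  obtains i where "i < n" "e = {(i, 0), (i, 1)}"
  | i k where "i < n" "k < 2" "e = {(i, k), (Suc i mod n, k)}"
proof -
  have verts: "verts (cycle_graph n) = {..<n}" "verts (complete_graph 2) = {..<2}"
    by (simp_all add: cycle_graph_def complete_graph_def)
  have "\<exists>v w x y. e = {(v, w), (x, y)} \<and> v < n \<and> w < 2 \<and>
      (v = x \<and> {w, y} \<in> edges (complete_graph 2) \<or> w = y \<and> {v, x} \<in> edges (cycle_graph n))"
    using assms by (simp add: cartesian_product_def verts) blast
  then obtain v w x y where e: "e = {(v, w), (x, y)}" and "v < n" "w < 2"
    and "v = x \<and> {w, y} \<in> edges (complete_graph 2) \<or> w = y \<and> {v, x} \<in> edges (cycle_graph n)"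
    by blast
  then consider "v = x" "{w, y} \<in> edges (complete_graph 2)"
    | "w = y" "{v, x} \<in> edges (cycle_graph n)"
    by blast
  then show ?thesis
  proof cases
    case 1
    then have "w = 0 \<and> y = 1 \<or> w = 1 \<and> y = 0"
      by (auto simp: complete_graph_def doubleton_eq_iff less_2_cases_iff)
    then have "e = {(v, 0), (v, 1)}"
      using e 1 by (auto simp: insert_commute)
    then show ?thesis
      using that(1) \<open>v < n\<close> by blast
  next
    case 2
    then obtain i where "i < n" "{v, x} = {i, Suc i mod n}"
      by (auto simp: cycle_graph_def)
    then have "e = {(i, w), (Suc i mod n, w)}"
      using e 2 by (auto simp: doubleton_eq_iff)
    then show ?thesis
      using that(2) \<open>i < n\<close> \<open>w < 2\<close> by blast
  qed
qed

theorem theorem1: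
  fixes n :: nat
  assumes "n \<ge> 3"
  shows "total_threshold_colorable 31 4 (cycle_graph n \<box> complete_graph 2)"
  unfolding total_threshold_colorable_def
proof (intro allI impI)
  let ?G = "cycle_graph n \<box> complete_graph 2"
  fix N F
  assume "near_far_labeling ?G N F"
  then have NF: "N \<subseteq> edges ?G" "F = edges ?G - N"
    by (auto simp: near_far_labeling_def)
  define rail where "rail k i \<longleftrightarrow> {(i mod n, k), (Suc i mod n, k)} \<in> N" for k i :: nat
  define rung where "rung i \<longleftrightarrow> {(i mod n, 0 :: nat), (i mod n, 1)} \<in> N" for i
  have "periodic n (rail k)" for k
    by (simp add: periodic_def rail_def flip: add_Suc)
  moreover have "periodic n rung"
    by (simp add: periodic_def rung_def)
  ultimately obtain a b where ab: "periodic n a" "periodic n b"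
    "\<forall>i. a i \<in> {0..30} \<and> b i \<in> {0..30} \<and> near (a i) (a (Suc i)) = rail 0 i \<and>
      near (b i) (b (Suc i)) = rail 1 i \<and> near (a i) (b i) = rung i"
    using prism_labels[OF assms] by metis
  \<comment> \<open>Every second coordinate other than 0 selects \<open>b\<close>, so the range
    bound holds for all pairs, not only for vertices.\<close>
  define c where "c v = (if snd v = 0 then a (fst v) else b (fst v))" for v :: "nat \<times> nat"
  have edge: "near (c u) (c v) \<longleftrightarrow> {u, v} \<in> N" if "{u, v} \<in> edges ?G" for u v
  proof -
    \<comment> \<open>An edge determines \<open>u\<close> and \<open>v\<close> only up to order, so
      the symmetry of \<open>near\<close> is needed to pass to the oriented form.\<close>
    have sym: "near (c u) (c v) = near (c x) (c y)" if "{u, v} = {x, y}" for x y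
      using that by (auto simp: doubleton_eq_iff near_def abs_minus_commute)
    show ?thesis
      using that
    proof (cases rule: prism_edge_cases)
      case (1 i)
      then show ?thesis
        using ab(3) sym[OF 1(2)] by (simp add: c_def rung_def)
    next
      case (2 i k)
      have "a (Suc i mod n) = a (Suc i)" "b (Suc i mod n) = b (Suc i)"
        using periodic_mod ab(1,2) by blast+
      moreover have "k = 0 \<or> k = 1"
        using 2(2) by auto
      ultimately show ?thesis
        using ab(3) sym[OF 2(3)] 2 by (auto simp: c_def rail_def)
    qed
  qed
  have "c v \<in> {0..31 - 1}" for v
    using ab(3) by (simp add: c_def)
  then have "threshold_coloring 31 4 ?G N F c"
    using edge NF by (fastforce simp: threshold_coloring_def near_def not_le)
  then show "\<exists>c. threshold_coloring 31 4 ?G N F c"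
    by blast
qed

end
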